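(* $$I(S_{2,1},\beta)=\begin{cases}\beta/4 & \text{if } 1/4\le\beta\le 1/2,\\ \beta^2(1-\beta) & \text{if } 1/2\le\beta\le 1.\end{cases}$$
   Context: A red/blue graph $H$ is a graph each of whose edges is colored red or blue (other pairs of vertices are unspecified). A red/blue clique $G$ is a complete graph each of whose edges is colored red or blue. For a red/blue graph $H$ with $h$ vertices and a red/blue clique $G$, $(\#H,G)$ denotes the number of injections $f:V(H)\to V(G)$ such that for every $uv\in E(H)$, the edge $f(u)f(v)$ of $G$ has the same color as $uv$. A sequence $(G_n)_{n\ge 1}$ of red/blue cliques has density $\beta$ if $|V(G_n)|=n$ and the proportion of edges of $G_n$ that are red tends to $\beta$. The sequence is $H$-good if $\rho(H,(G_n)):=\lim_{n\to\infty}(\#H,G_n)/n^h$ exists. $I(H,\beta)$ is the supremum of $\rho(H,(G_n))$ over all $H$-good sequences $(G_n)$ with density $\beta$. $S_{2,1}$ is the star with three edges (four vertices), two of which are red and one of which is blue. *)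

theory Defs
  imports Complex_Main "HOL-Library.FuncSet"
begin

record 'a rb_graph =
  verts :: "'a set"
  red_edges :: "'a set set"
  blue_edges :: "'a set set"

definition pairs :: "'a set \<Rightarrow> 'a set set" where
  "pairs V = {e. e \<subseteq> V \<and> card e = 2}"

definition is_rb_graph :: "'a rb_graph \<Rightarrow> bool" where
  "is_rb_graph H \<longleftrightarrow> finite (verts H) \<and> red_edges H \<inter> blue_edges H = {} \<and>
     red_edges H \<union> blue_edges H \<subseteq> pairs (verts H)"

definition is_rb_clique :: "'a rb_graph \<Rightarrow> bool" where
  "is_rb_clique G \<longleftrightarrow> is_rb_graph G \<and> red_edges G \<union> blue_edges G = pairs (verts G)"

text \<open>An injection on the vertices of \<open>H\<close> is represented by an extensional function, so that
  functions differing only outside the vertex set are not counted twice.\<close>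

definition rb_count :: "'a rb_graph \<Rightarrow> 'b rb_graph \<Rightarrow> nat" where
  "rb_count H G = card {f \<in> verts H \<rightarrow>\<^sub>E verts G. inj_on f (verts H) \<and>
     (\<forall>e\<in>red_edges H. f ` e \<in> red_edges G) \<and> (\<forall>e\<in>blue_edges H. f ` e \<in> blue_edges G)}"

text \<open>Sequences start at index 1; the value at index 0 is irrelevant. The quotient is \<open>0 / 0 = 0\<close>
  at index 1, which does not affect the limit.\<close>

definition clique_seq_density :: "(nat \<Rightarrow> 'b rb_graph) \<Rightarrow> real \<Rightarrow> bool" where
  "clique_seq_density G \<beta> \<longleftrightarrow> (\<forall>n\<ge>1. is_rb_clique (G n) \<and> card (verts (G n)) = n) \<and>
     (\<lambda>n. real (card (red_edges (G n))) / real (card (pairs (verts (G n))))) \<longlonglongrightarrow> \<beta>"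

definition rb_good :: "'a rb_graph \<Rightarrow> (nat \<Rightarrow> 'b rb_graph) \<Rightarrow> bool" where
  "rb_good H G \<longleftrightarrow> convergent (\<lambda>n. real (rb_count H (G n)) / real n ^ card (verts H))"

definition rb_rho :: "'a rb_graph \<Rightarrow> (nat \<Rightarrow> 'b rb_graph) \<Rightarrow> real" where
  "rb_rho H G = lim (\<lambda>n. real (rb_count H (G n)) / real n ^ card (verts H))"

text \<open>All notions are invariant under isomorphism, so cliques with vertices in \<open>nat\<close> represent
  all finite cliques. The supremum over the reals is meaningful because the set is bounded by 1
  (lemma \<open>rb_rho_le_1\<close>).\<close>

definition rb_inducibility :: "'a rb_graph \<Rightarrow> real \<Rightarrow> real" where
  "rb_inducibility H \<beta> =
     Sup {rb_rho H G | G :: nat \<Rightarrow> nat rb_graph. clique_seq_density G \<beta> \<and> rb_good H G}"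

lemma rb_count_le:
  assumes "finite (verts H)" "finite (verts G)"
  shows "rb_count H G \<le> card (verts G) ^ card (verts H)"
proof -
  have "rb_count H G \<le> card (verts H \<rightarrow>\<^sub>E verts G)"
    unfolding rb_count_def by (rule card_mono) (use assms in \<open>auto intro: finite_PiE\<close>)
  also have "\<dots> = card (verts G) ^ card (verts H)"
    by (simp add: card_PiE assms)
  finally show ?thesis .
qed

lemma rb_rho_le_1:
  assumes "is_rb_graph H" "clique_seq_density G \<beta>" "rb_good H G"
  shows "rb_rho H G \<le> 1"
proof -
  have "real (rb_count H (G n)) / real n ^ card (verts H) \<le> 1" if "n \<ge> 1" for n
  proof -
    have "rb_count H (G n) \<le> n ^ card (verts H)"
      using rb_count_le[of H "G n"] assms(1,2) that
      by (auto simp: is_rb_graph_def is_rb_clique_def clique_seq_density_def)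
    then have "real (rb_count H (G n)) \<le> real n ^ card (verts H)"
      by (metis of_nat_le_iff of_nat_power)
    then show ?thesis
      using that by (simp add: divide_le_eq)
  qed
  then show ?thesis
    using assms(3) unfolding rb_good_def rb_rho_def convergent_LIMSEQ_iff
    by (blast intro: LIMSEQ_le_const2)
qed

definition star_2_1 :: "nat rb_graph" where
  "star_2_1 = \<lparr>verts = {0, 1, 2, 3}, red_edges = {{0, 1}, {0, 2}}, blue_edges = {{0, 3}}\<rparr>"

lemma is_rb_graph_star_2_1: "is_rb_graph star_2_1"
  by (auto simp: is_rb_graph_def star_2_1_def pairs_def doubleton_eq_iff)

end

theory Submission
  imports Defs
begin

text \<open>
  A copy of the star is a centre \<open>v\<close> together with an ordered pair of distinct red neighbours and one
  blue neighbour, so the count in a clique on \<open>n\<close> vertices is the sum of \<open>r (r - 1) (n - 1 - r)\<close>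
  over the red degrees \<open>r\<close> (\<open>rb_count_star_2_1\<close>). Up to lower order terms the density of copies is
  therefore the average of \<open>f x = x\<^sup>2 (1 - x)\<close> over the normalised red degrees \<open>x = r / n\<close>, whose
  average is the red density \<open>\<beta>\<close>. Only the degree distribution matters, and Jensen's inequality bounds
  the average of \<open>f\<close> by the least concave majorant of \<open>f\<close> at \<open>\<beta>\<close>.

  Since \<open>f\<close> is convex on \<open>[0, 1/3]\<close> and concave afterwards, its concave majorant on \<open>[0, 1]\<close> is the
  tangent line through the origin, \<open>x / 4\<close>, up to the point of contact \<open>1/2\<close>, and \<open>f\<close> itself from
  there on. The bound is used in the form of a single supporting line (\<open>rb_rho_le_line\<close>).

  Equality needs the degree distribution of the extremal case of Jensen's inequality: all degrees
  about \<open>\<beta> n\<close> if \<open>\<beta> \<ge> 1/2\<close>, and otherwise about \<open>2 \<beta> n\<close> vertices of red degree about \<open>n / 2\<close>, all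
  others having red degree 0. Both are almost regular red graphs of degree about \<open>\<delta> n\<close> on about
  \<open>\<mu> n\<close> vertices, which exist as soon as \<open>\<delta> \<le> \<mu>\<close> (\<open>extremal_sequence_exists\<close>); with \<open>\<delta> = 1/2\<close> and
  \<open>\<mu> = 2 \<beta>\<close> this is exactly the hypothesis \<open>\<beta> \<ge> 1/4\<close>.
\<close>

section \<open>Counting stars by red degrees\<close>

definition red_deg :: "'a rb_graph \<Rightarrow> 'a \<Rightarrow> nat" where
  "red_deg G v = card {u. {v, u} \<in> red_edges G}"

lemma red_nbs_finite:
  assumes "is_rb_clique G"
  shows "finite {u. {v, u} \<in> red_edges G}" "finite {u. {v, u} \<in> blue_edges G}"
proof -
  have "{u. {v, u} \<in> red_edges G} \<union> {u. {v, u} \<in> blue_edges G} \<subseteq> verts G"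
    using assms by (auto simp: is_rb_clique_def is_rb_graph_def pairs_def)
  moreover have "finite (verts G)"
    using assms by (simp add: is_rb_clique_def is_rb_graph_def)
  ultimately show "finite {u. {v, u} \<in> red_edges G}" "finite {u. {v, u} \<in> blue_edges G}"
    by (auto intro: finite_subset)
qed

lemma red_deg_plus_blue_deg:
  assumes G: "is_rb_clique G" and v: "v \<in> verts G"
  shows "red_deg G v + card {u. {v, u} \<in> blue_edges G} = card (verts G) - 1"
proof -
  have fin: "finite (verts G)"
    and disj: "red_edges G \<inter> blue_edges G = {}"
    and un: "red_edges G \<union> blue_edges G = pairs (verts G)"
    using G by (auto simp: is_rb_clique_def is_rb_graph_def)
  have "red_deg G v + card {u. {v, u} \<in> blue_edges G}
      = card ({u. {v, u} \<in> red_edges G} \<union> {u. {v, u} \<in> blue_edges G})"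
    unfolding red_deg_def using disj red_nbs_finite[OF G]
    by (subst card_Un_disjoint) auto
  also have "{u. {v, u} \<in> red_edges G} \<union> {u. {v, u} \<in> blue_edges G}
      = {u. {v, u} \<in> pairs (verts G)}"
    using un by auto
  also have "\<dots> = verts G - {v}"
    using v by (auto simp: pairs_def card_insert_if)
  finally show ?thesis
    using v fin by simp
qed

lemma red_deg_less:
  assumes "is_rb_clique G" "v \<in> verts G"
  shows "red_deg G v < card (verts G)"
proof -
  have "card (verts G) > 0"
    using assms by (auto simp: card_gt_0_iff is_rb_clique_def is_rb_graph_def)
  then show ?thesis
    using red_deg_plus_blue_deg[OF assms] by linarith
qed

lemma card_verts_star_2_1: "card (verts star_2_1) = 4"
  by (simp add: star_2_1_def)

lemma rb_count_star_2_1: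
  assumes G: "is_rb_clique G"
  shows "rb_count star_2_1 G =
    (\<Sum>v\<in>verts G. red_deg G v * (red_deg G v - 1) * (card (verts G) - 1 - red_deg G v))"
proof -
  define R where "R v = {u. {v, u} \<in> red_edges G}" for v
  define B where "B v = {u. {v, u} \<in> blue_edges G}" for v
  define P where "P v = R v \<times> R v - Id_on (R v)" for v
  define S where "S = {f \<in> verts star_2_1 \<rightarrow>\<^sub>E verts G. inj_on f (verts star_2_1) \<and>
     (\<forall>e\<in>red_edges star_2_1. f ` e \<in> red_edges G) \<and>
     (\<forall>e\<in>blue_edges star_2_1. f ` e \<in> blue_edges G)}"
  define T where "T = (SIGMA v : verts G. P v \<times> B v)"
  have fin: "finite (verts G)"
    and disj: "red_edges G \<inter> blue_edges G = {}"
    and un: "red_edges G \<union> blue_edges G = pairs (verts G)"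
    using G by (auto simp: is_rb_clique_def is_rb_graph_def)
  have finR: "finite (R v)" and finB: "finite (B v)" for v
    using red_nbs_finite[OF G] by (auto simp: R_def B_def)
  have R: "u \<in> verts G \<and> u \<noteq> v" if "u \<in> R v" for u v
  proof -
    have "{v, u} \<in> pairs (verts G)" using un that by (auto simp: R_def)
    then show ?thesis by (cases "u = v") (auto simp: pairs_def)
  qed
  have B: "u \<in> verts G \<and> u \<noteq> v" if "u \<in> B v" for u v
  proof -
    have "{v, u} \<in> pairs (verts G)" using un that by (auto simp: B_def)
    then show ?thesis by (cases "u = v") (auto simp: pairs_def)
  qed
  have RB: "R v \<inter> B v = {}" for v
    using disj by (auto simp: R_def B_def)
  define F :: "(nat \<Rightarrow> 'a) \<Rightarrow> 'a \<times> ('a \<times> 'a) \<times> 'a" where "F f = (f 0, (f 1, f 2), f 3)" for f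
  define H :: "'a \<times> ('a \<times> 'a) \<times> 'a \<Rightarrow> nat \<Rightarrow> 'a" where
    "H = (\<lambda>(v, (a, b), c). \<lambda>x\<in>{0, 1, 2, 3}. if x = 0 then v else if x = 1 then a
       else if x = 2 then b else c)"
  have "bij_betw F S T"
  proof (rule bij_betw_byWitness[where f' = H])
    show "\<forall>f\<in>S. H (F f) = f"
      by (auto simp: S_def H_def F_def star_2_1_def PiE_iff extensional_def fun_eq_iff)
    show "\<forall>t\<in>T. F (H t) = t"
      by (auto simp: H_def F_def)
    show "F ` S \<subseteq> T"
      by (auto simp: S_def T_def F_def star_2_1_def P_def R_def B_def PiE_iff)
    show "H ` T \<subseteq> S"
    proof clarify
      fix v a b c assume t: "(v, (a, b), c) \<in> T"
      then have "v \<in> verts G" "a \<in> R v" "b \<in> R v" "a \<noteq> b" "c \<in> B v"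
        by (auto simp: T_def P_def)
      moreover from this have "a \<noteq> c" "b \<noteq> c" using RB by auto
      ultimately show "H (v, (a, b), c) \<in> S"
        using R[of a v] R[of b v] B[of c v]
        by (auto simp: S_def H_def star_2_1_def R_def B_def)
    qed
  qed
  then have "rb_count star_2_1 G = card T"
    unfolding rb_count_def S_def by (rule bij_betw_same_card)
  also have "\<dots> = (\<Sum>v\<in>verts G. card (P v \<times> B v))"
    unfolding T_def using fin finR finB by (intro card_SigmaI) (auto simp: P_def)
  also have "\<dots> = (\<Sum>v\<in>verts G. red_deg G v * (red_deg G v - 1) *
      (card (verts G) - 1 - red_deg G v))"
  proof (rule sum.cong[OF refl])
    fix v assume v: "v \<in> verts G"
    have "Id_on (R v) = (\<lambda>x. (x, x)) ` R v" by auto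
    then have "card (Id_on (R v)) = card (R v)"
      by (simp add: card_image inj_on_def)
    moreover have "card (P v) = card (R v \<times> R v) - card (Id_on (R v))"
      unfolding P_def using finR by (intro card_Diff_subset) (auto simp: Id_on_def)
    ultimately have "card (P v) = red_deg G v * (red_deg G v - 1)"
      by (simp add: card_cartesian_product R_def red_deg_def diff_mult_distrib2)
    moreover have "card (B v) = card (verts G) - 1 - red_deg G v"
      using red_deg_plus_blue_deg[OF G v] by (simp add: B_def)
    ultimately show "card (P v \<times> B v) = red_deg G v * (red_deg G v - 1) *
        (card (verts G) - 1 - red_deg G v)"
      by (simp add: card_cartesian_product)
  qed
  finally show ?thesis .
qed

lemma sum_red_deg:
  assumes G: "is_rb_clique G"
  shows "(\<Sum>v\<in>verts G. red_deg G v) = 2 * card (red_edges G)"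
proof -
  have fin: "finite (verts G)" and sub: "red_edges G \<subseteq> pairs (verts G)"
    using G by (auto simp: is_rb_clique_def is_rb_graph_def)
  have finr: "finite (red_edges G)"
    using sub fin by (rule_tac finite_subset[of _ "Pow (verts G)"]) (auto simp: pairs_def)
  have "red_deg G v = card {e \<in> red_edges G. v \<in> e}" for v
  proof -
    have "{e \<in> red_edges G. v \<in> e} = (\<lambda>u. {v, u}) ` {u. {v, u} \<in> red_edges G}"
    proof (intro equalityI subsetI)
      fix e assume e: "e \<in> {e \<in> red_edges G. v \<in> e}"
      then have "card e = 2" using sub by (auto simp: pairs_def)
      then obtain x y where "e = {x, y}" by (auto simp: card_2_iff)
      with e show "e \<in> (\<lambda>u. {v, u}) ` {u. {v, u} \<in> red_edges G}"
        by (auto simp: insert_commute)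
    qed auto
    moreover have "inj_on (\<lambda>u. {v, u}) A" for A
      by (auto simp: inj_on_def doubleton_eq_iff)
    ultimately show ?thesis
      unfolding red_deg_def by (simp add: card_image)
  qed
  then have "(\<Sum>v\<in>verts G. red_deg G v) = (\<Sum>v\<in>verts G. card {e \<in> red_edges G. v \<in> e})"
    by simp
  also have "\<dots> = (\<Sum>e\<in>red_edges G. 2)"
  proof (rule sum_multicount_gen[OF fin finr], rule ballI)
    fix e assume "e \<in> red_edges G"
    then have "{v \<in> verts G. v \<in> e} = e" "card e = 2"
      using sub by (auto simp: pairs_def)
    then show "card {v \<in> verts G. v \<in> e} = 2" by simp
  qed
  finally show ?thesis by simp
qed

section \<open>The upper bound\<close>

lemma card_pairs: "finite V \<Longrightarrow> card (pairs V) = card V choose 2"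
  unfolding pairs_def by (rule n_subsets)

lemma real_choose_2: "real (n choose 2) = real n * (real n - 1) / 2"
  by (cases n) (simp_all add: choose_two real_of_nat_div algebra_simps)

lemma density_eq_sum_red_deg:
  assumes "is_rb_clique G" "card (verts G) = n"
  shows "real (card (red_edges G)) / real (card (pairs (verts G)))
       = (\<Sum>v\<in>verts G. real (red_deg G v)) / (real n * (real n - 1))"
proof -
  have "finite (verts G)" using assms by (simp add: is_rb_clique_def is_rb_graph_def)
  then have "real (card (pairs (verts G))) = real n * (real n - 1) / 2"
    using assms by (simp add: card_pairs real_choose_2)
  moreover have "(\<Sum>v\<in>verts G. real (red_deg G v)) = 2 * real (card (red_edges G))"
    using sum_red_deg[OF assms(1)] by (metis of_nat_mult of_nat_numeral of_nat_sum)
  ultimately show ?thesis by (simp only:) simp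
qed

text \<open>Normalising by \<open>n\<^sup>2\<close> or by the number of ordered pairs makes no difference in the limit.\<close>

lemma LIMSEQ_pairs_normalisation:
  fixes s :: "nat \<Rightarrow> real"
  shows "(\<lambda>n. s n / (real n * (real n - 1))) \<longlonglongrightarrow> \<beta> \<longleftrightarrow> (\<lambda>n. s n / (real n)\<^sup>2) \<longlonglongrightarrow> \<beta>"
proof -
  have inv: "(\<lambda>n. 1 / real n) \<longlonglongrightarrow> 0" by (rule lim_1_over_n)
  have q: "(\<lambda>n. 1 - 1 / real n) \<longlonglongrightarrow> 1"
    using tendsto_diff[OF tendsto_const[of 1] inv] by simp
  have ev: "\<forall>\<^sub>F n in sequentially. s n / (real n)\<^sup>2 = s n / (real n * (real n - 1)) * (1 - 1 / real n)"
    using eventually_ge_at_top[of 2]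
    by eventually_elim (simp add: field_simps power2_eq_square)
  have ev': "\<forall>\<^sub>F n in sequentially. s n / (real n * (real n - 1)) = s n / (real n)\<^sup>2 / (1 - 1 / real n)"
    using eventually_ge_at_top[of 2]
    by eventually_elim (simp add: field_simps power2_eq_square)
  show ?thesis
  proof
    assume "(\<lambda>n. s n / (real n * (real n - 1))) \<longlonglongrightarrow> \<beta>"
    from tendsto_mult[OF this q] show "(\<lambda>n. s n / (real n)\<^sup>2) \<longlonglongrightarrow> \<beta>"
      by (simp add: tendsto_cong[OF ev])
  next
    assume "(\<lambda>n. s n / (real n)\<^sup>2) \<longlonglongrightarrow> \<beta>"
    from tendsto_divide[OF this q] show "(\<lambda>n. s n / (real n * (real n - 1))) \<longlonglongrightarrow> \<beta>"
      by (simp add: tendsto_cong[OF ev'])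
  qed
qed

lemma clique_seq_density_iff:
  "clique_seq_density G \<beta> \<longleftrightarrow> (\<forall>n\<ge>1. is_rb_clique (G n) \<and> card (verts (G n)) = n) \<and>
     (\<lambda>n. (\<Sum>v\<in>verts (G n). real (red_deg (G n) v)) / (real n)\<^sup>2) \<longlonglongrightarrow> \<beta>"
proof (cases "\<forall>n\<ge>1. is_rb_clique (G n) \<and> card (verts (G n)) = n")
  case True
  have "\<forall>\<^sub>F n in sequentially. real (card (red_edges (G n))) / real (card (pairs (verts (G n))))
      = (\<Sum>v\<in>verts (G n). real (red_deg (G n) v)) / (real n * (real n - 1))"
    using eventually_ge_at_top[of 1] by eventually_elim (use True in \<open>auto intro: density_eq_sum_red_deg\<close>)
  from tendsto_cong[OF this] show ?thesis
    unfolding clique_seq_density_def LIMSEQ_pairs_normalisation[symmetric] by simp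
qed (unfold clique_seq_density_def, blast)

text \<open>Jensen's inequality in the form in which it is needed: a line above \<open>x\<^sup>2 (1 - x)\<close> on \<open>[0, 1]\<close>
  can be averaged over the vertices, and its average depends on the red density alone.\<close>

lemma rb_rho_le_line:
  assumes line: "\<And>x. 0 \<le> x \<Longrightarrow> x \<le> 1 \<Longrightarrow> x\<^sup>2 * (1 - x) \<le> a * x + b"
    and dens: "clique_seq_density G \<beta>" and good: "rb_good star_2_1 G"
  shows "rb_rho star_2_1 G \<le> a * \<beta> + b"
proof -
  let ?s = "\<lambda>n. (\<Sum>v\<in>verts (G n). real (red_deg (G n) v)) / (real n)\<^sup>2"
  let ?q = "\<lambda>n. real (rb_count star_2_1 (G n)) / real n ^ 4"
  have lim: "?q \<longlonglongrightarrow> rb_rho star_2_1 G"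
    using good unfolding rb_good_def rb_rho_def convergent_LIMSEQ_iff card_verts_star_2_1 .
  have s: "?s \<longlonglongrightarrow> \<beta>" using dens by (simp add: clique_seq_density_iff)
  have "?q n \<le> a * ?s n + b" if n: "n \<ge> 1" for n
  proof -
    have G: "is_rb_clique (G n)" and card: "card (verts (G n)) = n"
      using dens n by (auto simp: clique_seq_density_def)
    have "?q n = (\<Sum>v\<in>verts (G n). real (red_deg (G n) v * (red_deg (G n) v - 1) *
        (n - 1 - red_deg (G n) v)) / real n ^ 4)"
      by (simp add: rb_count_star_2_1[OF G] card sum_divide_distrib)
    also have "\<dots> \<le> (\<Sum>v\<in>verts (G n). a * (real (red_deg (G n) v) / (real n)\<^sup>2) + b / real n)"
    proof (rule sum_mono)
      fix v assume v: "v \<in> verts (G n)"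
      define r where "r = red_deg (G n) v"
      have r: "r < n" using red_deg_less[OF G v] by (simp add: card r_def)
      have "real (r * (r - 1) * (n - 1 - r)) \<le> real (r * r * (n - r))"
        unfolding of_nat_le_iff by (intro mult_mono) auto
      also have "\<dots> = real n ^ 3 * ((real r / real n)\<^sup>2 * (1 - real r / real n))"
        using r by (simp add: field_simps power2_eq_square power3_eq_cube)
      also have "\<dots> \<le> real n ^ 3 * (a * (real r / real n) + b)"
        using r by (intro mult_left_mono line) auto
      finally have "real (r * (r - 1) * (n - 1 - r)) / real n ^ 4
          \<le> real n ^ 3 * (a * (real r / real n) + b) / real n ^ 4"
        by (rule divide_right_mono) simp
      also have "\<dots> = a * (real r / (real n)\<^sup>2) + b / real n"
        using r by (simp add: field_simps power2_eq_square power3_eq_cube power4_eq_xxxx)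
      finally show "real (red_deg (G n) v * (red_deg (G n) v - 1) * (n - 1 - red_deg (G n) v))
          / real n ^ 4 \<le> a * (real (red_deg (G n) v) / (real n)\<^sup>2) + b / real n"
        by (simp add: r_def)
    qed
    also have "\<dots> = a * ?s n + b"
      using n by (simp add: sum.distrib card sum_distrib_left sum_divide_distrib)
    finally show ?thesis .
  qed
  moreover have "(\<lambda>n. a * ?s n + b) \<longlonglongrightarrow> a * \<beta> + b"
    by (intro tendsto_intros s)
  ultimately show ?thesis
    using LIMSEQ_le[OF lim] by blast
qed

section \<open>Extremal cliques\<close>

text \<open>The red graph is a Cayley sum graph of the integers modulo \<open>m\<close>. The condition on \<open>i + j\<close> is
  symmetric and \<open>j \<mapsto> i + j\<close> permutes the residues, so the red degrees on \<open>{..<m}\<close> agree up to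
  the loop that is left out.\<close>

definition sum_clique :: "nat \<Rightarrow> nat \<Rightarrow> nat \<Rightarrow> nat rb_graph" where
  "sum_clique n m d = (let R = {{i, j} | i j. i < m \<and> j < m \<and> i \<noteq> j \<and> (i + j) mod m < d}
     in \<lparr>verts = {..<n}, red_edges = R, blue_edges = pairs {..<n} - R\<rparr>)"

lemma verts_sum_clique [simp]: "verts (sum_clique n m d) = {..<n}"
  by (simp add: sum_clique_def Let_def)

lemma is_rb_clique_sum_clique: "m \<le> n \<Longrightarrow> is_rb_clique (sum_clique n m d)"
  by (auto simp: sum_clique_def Let_def is_rb_clique_def is_rb_graph_def pairs_def)

lemma card_shift_mod_less:
  fixes m d i :: nat
  assumes "d \<le> m"
  shows "card {j. j < m \<and> (i + j) mod m < d} = d"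
proof -
  have inj: "inj_on (\<lambda>j. (i + j) mod m) {..<m}"
  proof (rule inj_onI)
    fix x y assume xy: "x \<in> {..<m}" "y \<in> {..<m}" "(i + x) mod m = (i + y) mod m"
    have "int (i + x) mod int m = int (i + y) mod int m"
      using xy(3) by (metis zmod_int)
    then have "int x mod int m = int y mod int m"
      by (simp add: mod_eq_dvd_iff)
    with xy show "x = y" by simp
  qed
  moreover have "(\<lambda>j. (i + j) mod m) ` {..<m} \<subseteq> {..<m}" by auto
  ultimately have "bij_betw (\<lambda>j. (i + j) mod m) {..<m} {..<m}"
    by (simp add: bij_betw_def endo_inj_surj)
  then have im: "(\<lambda>j. (i + j) mod m) ` {..<m} = {..<m}"
    by (simp add: bij_betw_def)
  have "(\<lambda>j. (i + j) mod m) ` {j. j < m \<and> (i + j) mod m < d} = {..<d}"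
  proof
    show "{..<d} \<subseteq> (\<lambda>j. (i + j) mod m) ` {j. j < m \<and> (i + j) mod m < d}"
    proof
      fix k assume k: "k \<in> {..<d}"
      then have "k \<in> (\<lambda>j. (i + j) mod m) ` {..<m}" using im assms by auto
      then show "k \<in> (\<lambda>j. (i + j) mod m) ` {j. j < m \<and> (i + j) mod m < d}" using k by auto
    qed
  qed auto
  moreover have "inj_on (\<lambda>j. (i + j) mod m) {j. j < m \<and> (i + j) mod m < d}"
    by (rule inj_on_subset[OF inj]) auto
  ultimately show ?thesis by (metis card_image card_lessThan)
qed

lemma red_deg_sum_clique:
  assumes "d \<le> m"
  shows "i < m \<Longrightarrow> red_deg (sum_clique n m d) i = d \<or> red_deg (sum_clique n m d) i + 1 = d"
    and "\<not> i < m \<Longrightarrow> red_deg (sum_clique n m d) i = 0"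
proof -
  have N: "{u. {i, u} \<in> red_edges (sum_clique n m d)}
      = (if i < m then {j. j < m \<and> (i + j) mod m < d} - {i} else {})"
    by (auto simp: sum_clique_def Let_def doubleton_eq_iff add.commute)
  show "red_deg (sum_clique n m d) i = 0" if "\<not> i < m"
    using that unfolding red_deg_def N by simp
  have "finite {j. j < m \<and> (i + j) mod m < d}" by simp
  then show "red_deg (sum_clique n m d) i = d \<or> red_deg (sum_clique n m d) i + 1 = d" if "i < m"
    using that card_shift_mod_less[OF assms, of i] card_gt_0_iff[of "{j. j < m \<and> (i + j) mod m < d}"]
    unfolding red_deg_def N by (auto simp: card_Diff_singleton_if)
qed

lemma sum_red_deg_sum_clique:
  assumes "d \<le> m" "m \<le> n"
  shows "\<bar>(\<Sum>v<n. real (red_deg (sum_clique n m d) v)) - real m * real d\<bar> \<le> real n"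
proof -
  let ?r = "red_deg (sum_clique n m d)"
  have "(\<Sum>v<n. real (?r v)) = (\<Sum>v<m. real (?r v))"
    using assms red_deg_sum_clique(2)[OF assms(1)] by (intro sum.mono_neutral_right) auto
  then have "\<bar>(\<Sum>v<n. real (?r v)) - real m * real d\<bar> = \<bar>\<Sum>v<m. real (?r v) - real d\<bar>"
    by (simp add: sum_subtractf)
  also have "\<dots> \<le> (\<Sum>v<m. \<bar>real (?r v) - real d\<bar>)" by (rule sum_abs)
  also have "\<dots> \<le> (\<Sum>v<m. 1)"
  proof (rule sum_mono)
    fix v assume "v \<in> {..<m}"
    then have "?r v = d \<or> ?r v + 1 = d"
      using red_deg_sum_clique(1)[OF assms(1)] by simp
    then show "\<bar>real (?r v) - real d\<bar> \<le> 1" by auto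
  qed
  finally show ?thesis using assms by simp
qed

lemma star_term_error:
  fixes r d n :: nat
  assumes "d \<le> n" "r < n" "r = d \<or> r + 1 = d"
  shows "\<bar>real (r * (r - 1) * (n - 1 - r)) - (real d)\<^sup>2 * (real n - real d)\<bar> \<le> 3 * (real n)\<^sup>2"
proof -
  have r1: "real (r * (r - 1)) = real r * (real r - 1)" by (cases r) (auto simp: algebra_simps)
  have n1: "real (n - 1 - r) = real n - 1 - real r" using assms by linarith
  have eq: "real (r * (r - 1) * (n - 1 - r)) = real r * (real r - 1) * (real n - 1 - real r)"
    by (metis r1 n1 of_nat_mult)
  show ?thesis
  proof (cases "r = d")
    case True
    have "real r * (real r - 1) * (real n - 1 - real r) - (real d)\<^sup>2 * (real n - real d)
        = - (real d * (real n - 1))"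
      unfolding True by (simp add: algebra_simps power2_eq_square)
    moreover have "0 \<le> real d * (real n - 1)" using assms by auto
    moreover have "real d * (real n - 1) \<le> real n * real n"
      using assms by (intro mult_mono) auto
    moreover have "0 \<le> real n * real n" by simp
    ultimately show ?thesis unfolding eq power2_eq_square[of "real n"] by linarith
  next
    case False
    with assms have d: "real r = real d - 1" "real d \<ge> 1" by auto
    have "real r * (real r - 1) * (real n - 1 - real r) - (real d)\<^sup>2 * (real n - real d)
        = - ((3 * real d - 2) * (real n - real d))"
      unfolding d by (simp add: algebra_simps power2_eq_square)
    moreover have "0 \<le> (3 * real d - 2) * (real n - real d)" using assms d by auto
    moreover have "(3 * real d - 2) * (real n - real d) \<le> (3 * real n) * real n"
      using assms d by (intro mult_mono) auto
    ultimately show ?thesis unfolding eq power2_eq_square[of "real n"] by linarith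
  qed
qed

lemma rb_count_sum_clique:
  assumes "d \<le> m" "m \<le> n"
  shows "\<bar>real (rb_count star_2_1 (sum_clique n m d)) - real m * (real d)\<^sup>2 * (real n - real d)\<bar>
       \<le> 3 * real n ^ 3"
proof -
  let ?r = "red_deg (sum_clique n m d)"
  let ?t = "\<lambda>v. real (?r v * (?r v - 1) * (n - 1 - ?r v))"
  note G = is_rb_clique_sum_clique[OF assms(2), of d]
  have "real (rb_count star_2_1 (sum_clique n m d)) = (\<Sum>v<n. ?t v)"
    by (simp add: rb_count_star_2_1[OF G])
  also have "\<dots> = (\<Sum>v<m. ?t v)"
    using assms red_deg_sum_clique(2)[OF assms(1)] by (intro sum.mono_neutral_right) auto
  finally have "\<bar>real (rb_count star_2_1 (sum_clique n m d)) - real m * (real d)\<^sup>2 * (real n - real d)\<bar>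
      = \<bar>\<Sum>v<m. ?t v - (real d)\<^sup>2 * (real n - real d)\<bar>"
    by (simp only: sum_subtractf sum_constant card_lessThan mult.assoc)
  also have "\<dots> \<le> (\<Sum>v<m. \<bar>?t v - (real d)\<^sup>2 * (real n - real d)\<bar>)" by (rule sum_abs)
  also have "\<dots> \<le> (\<Sum>v<m. 3 * (real n)\<^sup>2)"
  proof (intro sum_mono star_term_error)
    fix v assume v: "v \<in> {..<m}"
    show "d \<le> n" using assms by simp
    show "?r v < n" using red_deg_less[OF G, of v] v assms by simp
    show "?r v = d \<or> ?r v + 1 = d" using red_deg_sum_clique(1)[OF assms(1)] v by simp
  qed
  also have "\<dots> = real m * (3 * (real n)\<^sup>2)" by simp
  also have "\<dots> \<le> real n * (3 * (real n)\<^sup>2)"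
    using assms by (intro mult_right_mono) auto
  finally show ?thesis by (simp add: power2_eq_square power3_eq_cube)
qed

lemma LIMSEQ_nat_floor_over_n:
  fixes c :: real
  assumes "c \<ge> 0"
  shows "(\<lambda>n. real (nat \<lfloor>c * real n\<rfloor>) / real n) \<longlonglongrightarrow> c"
proof (rule real_tendsto_sandwich)
  have fl: "c * real n - 1 \<le> real (nat \<lfloor>c * real n\<rfloor>)" "real (nat \<lfloor>c * real n\<rfloor>) \<le> c * real n" for n
  proof -
    have "0 \<le> c * real n" using assms by simp
    then show "c * real n - 1 \<le> real (nat \<lfloor>c * real n\<rfloor>)" "real (nat \<lfloor>c * real n\<rfloor>) \<le> c * real n"
      by linarith+
  qed
  show "\<forall>\<^sub>F n in sequentially. c - 1 / real n \<le> real (nat \<lfloor>c * real n\<rfloor>) / real n"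
    using eventually_gt_at_top[of 0]
    by eventually_elim (use fl(1) in \<open>simp add: pos_le_divide_eq left_diff_distrib\<close>)
  show "\<forall>\<^sub>F n in sequentially. real (nat \<lfloor>c * real n\<rfloor>) / real n \<le> c"
    using eventually_gt_at_top[of 0]
    by eventually_elim (use fl(2) in \<open>simp add: pos_divide_le_eq\<close>)
  show "(\<lambda>n. c - 1 / real n) \<longlonglongrightarrow> c"
    using tendsto_diff[OF tendsto_const[of c] lim_1_over_n] by simp
qed simp

lemma LIMSEQ_of_error_over_n:
  fixes s t :: "nat \<Rightarrow> real"
  assumes t: "t \<longlonglongrightarrow> l" and err: "\<And>n. n \<ge> 1 \<Longrightarrow> \<bar>s n - t n\<bar> \<le> K / real n"
  shows "s \<longlonglongrightarrow> l"
proof -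
  have "(\<lambda>n. K / real n) \<longlonglongrightarrow> 0"
    by (rule lim_const_over_n)
  then have "(\<lambda>n. s n - t n) \<longlonglongrightarrow> 0"
  proof (rule tendsto_0_le[where K = 1])
    show "\<forall>\<^sub>F n in sequentially. norm (s n - t n) \<le> norm (K / real n) * 1"
      using eventually_ge_at_top[of 1]
    proof eventually_elim
      case (elim n)
      then show ?case using order.trans[OF err abs_ge_self] by simp
    qed
  qed
  from tendsto_add[OF this t] show ?thesis by simp
qed

lemma extremal_sequence_exists:
  assumes "0 \<le> \<delta>" "\<delta> \<le> \<mu>" "\<mu> \<le> 1"
  obtains G :: "nat \<Rightarrow> nat rb_graph" where "clique_seq_density G (\<mu> * \<delta>)"
    "(\<lambda>n. real (rb_count star_2_1 (G n)) / real n ^ 4) \<longlonglongrightarrow> \<mu> * (\<delta>\<^sup>2 * (1 - \<delta>))"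
proof
  define m where "m n = nat \<lfloor>\<mu> * real n\<rfloor>" for n
  define d where "d n = nat \<lfloor>\<delta> * real n\<rfloor>" for n
  define G where "G n = sum_clique n (m n) (d n)" for n
  have dm: "d n \<le> m n" for n
    unfolding d_def m_def using assms by (intro nat_mono floor_mono mult_right_mono) auto
  have mn: "m n \<le> n" for n
  proof -
    have "\<mu> * real n \<le> 1 * real n" using assms by (intro mult_right_mono) auto
    then show ?thesis unfolding m_def by linarith
  qed
  have m: "(\<lambda>n. real (m n) / real n) \<longlonglongrightarrow> \<mu>" and d: "(\<lambda>n. real (d n) / real n) \<longlonglongrightarrow> \<delta>"
    unfolding m_def d_def using assms by (intro LIMSEQ_nat_floor_over_n; simp)+
  have "(\<lambda>n. (\<Sum>v<n. real (red_deg (G n) v)) / (real n)\<^sup>2) \<longlonglongrightarrow> \<mu> * \<delta>"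
  proof (rule LIMSEQ_of_error_over_n[OF tendsto_mult[OF m d]])
    fix n :: nat assume n: "n \<ge> 1"
    let ?S = "\<Sum>v<n. real (red_deg (G n) v)"
    have "?S / (real n)\<^sup>2 - real (m n) / real n * (real (d n) / real n)
        = (?S - real (m n) * real (d n)) / (real n)\<^sup>2"
      by (simp add: power2_eq_square diff_divide_distrib)
    then have "\<bar>?S / (real n)\<^sup>2 - real (m n) / real n * (real (d n) / real n)\<bar>
        = \<bar>?S - real (m n) * real (d n)\<bar> / (real n)\<^sup>2"
      by simp
    also have "\<dots> \<le> real n / (real n)\<^sup>2"
      unfolding G_def by (intro divide_right_mono sum_red_deg_sum_clique dm mn) simp
    finally show "\<bar>?S / (real n)\<^sup>2 - real (m n) / real n * (real (d n) / real n)\<bar> \<le> 1 / real n"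
      using n by (simp add: power2_eq_square)
  qed
  then show "clique_seq_density G (\<mu> * \<delta>)"
    unfolding clique_seq_density_iff
    by (simp add: G_def is_rb_clique_sum_clique mn)
  show "(\<lambda>n. real (rb_count star_2_1 (G n)) / real n ^ 4) \<longlonglongrightarrow> \<mu> * (\<delta>\<^sup>2 * (1 - \<delta>))"
  proof (rule LIMSEQ_of_error_over_n)
    show "(\<lambda>n. real (m n) / real n * ((real (d n) / real n)\<^sup>2 * (1 - real (d n) / real n)))
        \<longlonglongrightarrow> \<mu> * (\<delta>\<^sup>2 * (1 - \<delta>))"
      by (intro tendsto_intros m d)
    fix n :: nat assume n: "n \<ge> 1"
    let ?c = "real (rb_count star_2_1 (G n))"
    let ?t = "real (m n) / real n * ((real (d n) / real n)\<^sup>2 * (1 - real (d n) / real n))"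
    have "?c / real n ^ 4 - ?t
        = (?c - real (m n) * (real (d n))\<^sup>2 * (real n - real (d n))) / real n ^ 4"
      using n by (simp add: field_simps power2_eq_square power4_eq_xxxx)
    then have "\<bar>?c / real n ^ 4 - ?t\<bar>
        = \<bar>?c - real (m n) * (real (d n))\<^sup>2 * (real n - real (d n))\<bar> / real n ^ 4"
      by simp
    also have "\<dots> \<le> 3 * real n ^ 3 / real n ^ 4"
      unfolding G_def by (intro divide_right_mono rb_count_sum_clique dm mn) simp
    finally show "\<bar>?c / real n ^ 4 - ?t\<bar> \<le> 3 / real n"
      using n by (simp add: power3_eq_cube power4_eq_xxxx)
  qed
qed

lemma rb_inducibility_star_2_1_eqI:
  assumes line: "\<And>x. 0 \<le> x \<Longrightarrow> x \<le> 1 \<Longrightarrow> x\<^sup>2 * (1 - x) \<le> a * x + b"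
    and "0 \<le> \<delta>" "\<delta> \<le> \<mu>" "\<mu> \<le> 1" and \<beta>: "\<beta> = \<mu> * \<delta>"
    and tight: "\<mu> * (\<delta>\<^sup>2 * (1 - \<delta>)) = a * \<beta> + b"
  shows "rb_inducibility star_2_1 \<beta> = a * \<beta> + b"
proof -
  obtain G :: "nat \<Rightarrow> nat rb_graph" where G: "clique_seq_density G \<beta>"
    and lim: "(\<lambda>n. real (rb_count star_2_1 (G n)) / real n ^ 4) \<longlonglongrightarrow> a * \<beta> + b"
    using extremal_sequence_exists[OF assms(2-4)] unfolding \<beta>[symmetric] tight by blast
  have "rb_good star_2_1 G" "rb_rho star_2_1 G = a * \<beta> + b"
    using lim convergentI[OF lim] limI[OF lim]
    unfolding rb_good_def rb_rho_def card_verts_star_2_1 by blast+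
  with G have "a * \<beta> + b \<in> {rb_rho star_2_1 G | G :: nat \<Rightarrow> nat rb_graph.
      clique_seq_density G \<beta> \<and> rb_good star_2_1 G}"
    by force
  then show ?thesis
    unfolding rb_inducibility_def
    by (rule cSup_eq_maximum) (use rb_rho_le_line[OF line] in auto)
qed

theorem mainTheorem6:
  fixes \<beta> :: real
  shows "(1/4 \<le> \<beta> \<and> \<beta> \<le> 1/2 \<longrightarrow> rb_inducibility star_2_1 \<beta> = \<beta> / 4) \<and>
         (1/2 \<le> \<beta> \<and> \<beta> \<le> 1 \<longrightarrow> rb_inducibility star_2_1 \<beta> = \<beta>\<^sup>2 * (1 - \<beta>))"
proof (intro conjI impI)
  assume \<beta>: "1/4 \<le> \<beta> \<and> \<beta> \<le> 1/2"
  have "rb_inducibility star_2_1 \<beta> = 1/4 * \<beta> + 0"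
  proof (rule rb_inducibility_star_2_1_eqI[where \<delta> = "1/2" and \<mu> = "2 * \<beta>"])
    fix x :: real assume "0 \<le> x"
    then have "0 \<le> x * (x - 1/2)\<^sup>2" by simp
    also have "\<dots> = 1/4 * x + 0 - x\<^sup>2 * (1 - x)" by (simp add: field_simps power2_eq_square)
    finally show "x\<^sup>2 * (1 - x) \<le> 1/4 * x + 0" by simp
  qed (use \<beta> in \<open>auto simp: power2_eq_square\<close>)
  then show "rb_inducibility star_2_1 \<beta> = \<beta> / 4" by simp
next
  assume \<beta>: "1/2 \<le> \<beta> \<and> \<beta> \<le> 1"
  (* The line is the tangent to x^2 (1 - x) at \<beta>; their difference is a cubic with a double zero at
     \<beta> and third zero 1 - 2 \<beta>, which is not positive. *)
  let ?a = "2 * \<beta> - 3 * \<beta>\<^sup>2" and ?b = "2 * \<beta> ^ 3 - \<beta>\<^sup>2"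
  have "rb_inducibility star_2_1 \<beta> = ?a * \<beta> + ?b"
  proof (rule rb_inducibility_star_2_1_eqI[where \<delta> = \<beta> and \<mu> = 1])
    fix x :: real assume "0 \<le> x"
    then have "0 \<le> (x - \<beta>)\<^sup>2 * (x - (1 - 2 * \<beta>))" using \<beta> by simp
    also have "\<dots> = ?a * x + ?b - x\<^sup>2 * (1 - x)"
      by (simp add: algebra_simps power2_eq_square power3_eq_cube)
    finally show "x\<^sup>2 * (1 - x) \<le> ?a * x + ?b" by simp
  qed (use \<beta> in \<open>auto simp: algebra_simps power2_eq_square power3_eq_cube\<close>)
  also have "\<dots> = \<beta>\<^sup>2 * (1 - \<beta>)"
    by (simp add: algebra_simps power2_eq_square power3_eq_cube)
  finally show "rb_inducibility star_2_1 \<beta> = \<beta>\<^sup>2 * (1 - \<beta>)" .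
qed

end
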